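(* Let $G$ be the group of move sequences of the $2\times 2\times 2$ Varikon Box, i.e. the group of finite sequences in the moves $R,U,B$, two sequences being identified when they induce the same map on the set $V$ of reachable configurations, with concatenation as group operation. Then $$G \cong S_7\times(\mathbb{Z}_2)^2 .$$
   Context: The $2\times2\times2$ Varikon Box consists of the eight cells $\{0,1\}^3=(\mathbb{Z}_2)^3$ of a $2\times2\times2$ grid, filled with seven distinct pieces labelled $1,\dots,7$ and one empty space. A configuration is a bijection between $\{1,\dots,7,\text{empty}\}$ and the eight cells. The solved configuration $\iota$ has the empty space in cell $(0,0,0)$ and pieces $7,4,6,3,2,5,1$ in cells $(1,0,0),(0,1,0),(0,0,1),(1,1,0),(0,1,1),(1,0,1),(1,1,1)$ respectively. The moves $R$ (right), $U$ (up), $B$ (back) are defined on every configuration: if the empty space is in cell $p$, then $R$ (resp. $U$, $B$) swaps the empty space with the piece in the cell $p+(1,0,0)$ (resp. $p+(0,1,0)$, $p+(0,0,1)$), addition taken in $(\mathbb{Z}_2)^3$. Thus each of $R^2,U^2,B^2$ is the identity. Let $V$ be the set of configurations reachable from $\iota$ by finite sequences of moves. Sequences are performed from left to right, and two sequences are considered equal if they induce the same map $V\to V$. *)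

theory Defs
  imports
    "HOL-Algebra.Elementary_Groups"
    "HOL-Algebra.Sym_Groups"
    "HOL-Library.Z2"
    "HOL-Library.Product_Plus"
begin

type_synonym cell = "bit \<times> bit \<times> bit"

text \<open>
  A configuration maps each cell to its content: \<open>Some k\<close> stands for the piece \<open>k\<close>,
  \<open>None\<close> for the empty space.
\<close>

type_synonym config = "cell \<rightharpoonup> nat"

definition configurations :: "config set" where
  "configurations = {c. bij_betw c UNIV (insert None (Some ` {1..7}))}"

definition solved :: config where
  "solved =
     [(1, 0, 0) \<mapsto> 7, (0, 1, 0) \<mapsto> 4, (0, 0, 1) \<mapsto> 6,
      (1, 1, 0) \<mapsto> 3, (0, 1, 1) \<mapsto> 2, (1, 0, 1) \<mapsto> 5, (1, 1, 1) \<mapsto> 1]"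

definition empty_cell :: "config \<Rightarrow> cell" where
  "empty_cell c = (THE p. c p = None)"

datatype move = Right | Up | Back

fun direction :: "move \<Rightarrow> cell" where
  "direction Right = (1, 0, 0)"
| "direction Up = (0, 1, 0)"
| "direction Back = (0, 0, 1)"

definition apply_move :: "move \<Rightarrow> config \<Rightarrow> config" where
  "apply_move m c =
     c \<circ> Transposition.transpose (empty_cell c) (empty_cell c + direction m)"

text \<open>\<open>fold\<close> performs the head of the list first, i.e. sequences run from left to right.\<close>

definition run :: "move list \<Rightarrow> config \<Rightarrow> config" where
  "run w = fold apply_move w"

definition reachable :: "config set" where
  "reachable = {run w solved | w. True}"

definition same_effect :: "(move list \<times> move list) set" where
  "same_effect = {(u, v). \<forall>c\<in>reachable. run u c = run v c}"

definition varikon_group :: "move list set monoid" where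
  "varikon_group =
     \<lparr>carrier = UNIV // same_effect,
      monoid.mult = (\<lambda>X Y. \<Union>u\<in>X. \<Union>v\<in>Y. same_effect `` {u @ v}),
      one = same_effect `` {[]}\<rparr>"


lemma UNIV_bit: "(UNIV :: bit set) = {0, 1}"
  by (auto intro: bit.exhaust)

lemma solved_configuration: "solved \<in> configurations"
proof -
  have U: "(UNIV :: cell set) = {(0,0,0), (1,0,0), (0,1,0), (0,0,1), (1,1,0), (0,1,1), (1,0,1), (1,1,1)}"
    unfolding UNIV_Times_UNIV[symmetric] UNIV_bit by auto
  have "{1..7} = {1, 2, 3, 4, 5, 6, 7 :: nat}"
    by auto
  then have r: "range solved = insert None (Some ` {1..7})"
    unfolding solved_def U image_insert image_empty by (simp, blast)
  have "card (range solved) = 8"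
    unfolding r by (simp add: card_image)
  moreover have "card (UNIV :: cell set) = 8"
    unfolding U by simp
  ultimately have "card (range solved) = card (UNIV :: cell set)"
    by simp
  then have "inj solved"
    by (intro eq_card_imp_inj_on) (simp add: U)
  with r show ?thesis
    by (simp add: configurations_def bij_betw_def)
qed

lemma empty_cell_eq:
  assumes "c \<in> configurations"
  shows "c p = None \<longleftrightarrow> p = empty_cell c"
proof -
  have "inj c" "None \<in> range c"
    using assms by (auto simp: configurations_def bij_betw_def)
  then obtain q where q: "c q = None"
    by (metis rangeE)
  have iff: "c p = None \<longleftrightarrow> p = q" for p
    using q injD[OF \<open>inj c\<close>, of p q] by auto
  then have "empty_cell c = q"
    by (simp add: empty_cell_def)
  with iff show ?thesis
    by simp
qed

lemma apply_move_configuration: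
  assumes "c \<in> configurations"
  shows "apply_move m c \<in> configurations"
  using assms unfolding configurations_def apply_move_def mem_Collect_eq
  by (rule bij_betw_trans[rotated]) (rule bij_transpose)

lemma apply_move_involutive:
  assumes "c \<in> configurations"
  shows "apply_move m (apply_move m c) = c"
proof -
  let ?p = "empty_cell c" and ?q = "empty_cell c + direction m"
  have "apply_move m c ?q = None"
    using empty_cell_eq[OF assms, of ?p] by (simp add: apply_move_def)
  then have e: "empty_cell (apply_move m c) = ?q"
    using empty_cell_eq[OF apply_move_configuration[OF assms]] by metis
  have d: "?q + direction m = ?p"
    by (cases m; cases ?p) (auto simp: add.assoc)
  show ?thesis
    unfolding apply_move_def[of m "apply_move m c"] e d
    by (simp add: apply_move_def fun_eq_iff transpose_commute[of ?q ?p])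
qed

lemma run_Nil [simp]: "run [] c = c"
  by (simp add: run_def)

lemma run_append: "run (u @ v) c = run v (run u c)"
  by (simp add: run_def)

lemma run_configuration: "c \<in> configurations \<Longrightarrow> run w c \<in> configurations"
  unfolding run_def by (induction w arbitrary: c) (simp_all add: apply_move_configuration)

lemma reachable_subset_configurations: "reachable \<subseteq> configurations"
  by (auto simp: reachable_def intro: run_configuration solved_configuration)

lemma run_reachable: "c \<in> reachable \<Longrightarrow> run w c \<in> reachable"
  unfolding reachable_def by (auto simp flip: run_append)

lemma run_rev:
  assumes "c \<in> configurations"
  shows "run (w @ rev w) c = c"
  using assms
proof (induction w arbitrary: c)
  case (Cons m w)
  have "run (w @ rev w) (apply_move m c) = apply_move m c"
    by (intro Cons apply_move_configuration)
  then show ?case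
    using apply_move_involutive[OF Cons.prems] by (simp add: run_def)
qed simp

lemma equiv_same_effect: "equiv UNIV same_effect"
  by (rule equivI) (auto simp: same_effect_def refl_on_def sym_def trans_def)

lemma varikon_group_mult:
  "same_effect `` {u} \<otimes>\<^bsub>varikon_group\<^esub> same_effect `` {v} = same_effect `` {u @ v}"
proof -
  have "(\<lambda>u v. same_effect `` {u @ v}) respects2 same_effect"
    by (rule congruent2I'; rule equiv_class_eq[OF equiv_same_effect])
      (auto simp: same_effect_def run_append run_reachable)
  then show ?thesis
    unfolding varikon_group_def monoid.simps
    by (intro UN_equiv_class2[OF equiv_same_effect equiv_same_effect]) auto
qed

lemma group_varikon_group: "group varikon_group"
proof (rule groupI)
  have cl: "\<exists>u. X = same_effect `` {u}" if "X \<in> carrier varikon_group" for X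
    using that by (auto simp: varikon_group_def quotient_def)
  have in_carrier: "same_effect `` {u} \<in> carrier varikon_group" for u
    by (auto simp: varikon_group_def quotient_def)
  have one: "\<one>\<^bsub>varikon_group\<^esub> = same_effect `` {[]}"
    by (simp add: varikon_group_def)
  show "\<one>\<^bsub>varikon_group\<^esub> \<in> carrier varikon_group"
    unfolding one by (rule in_carrier)
  fix X assume "X \<in> carrier varikon_group"
  then obtain u where u: "X = same_effect `` {u}"
    using cl by blast
  show "\<one>\<^bsub>varikon_group\<^esub> \<otimes>\<^bsub>varikon_group\<^esub> X = X"
    unfolding one u varikon_group_mult by simp
  have "(rev u @ u, []) \<in> same_effect"
    using run_rev[of _ "rev u"] reachable_subset_configurations
    by (auto simp: same_effect_def)
  then have "same_effect `` {rev u} \<otimes>\<^bsub>varikon_group\<^esub> X = \<one>\<^bsub>varikon_group\<^esub>"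
    unfolding one u varikon_group_mult by (rule equiv_class_eq[OF equiv_same_effect])
  then show "\<exists>Y\<in>carrier varikon_group. Y \<otimes>\<^bsub>varikon_group\<^esub> X = \<one>\<^bsub>varikon_group\<^esub>"
    using in_carrier by blast
  fix Y assume "Y \<in> carrier varikon_group"
  then obtain v where v: "Y = same_effect `` {v}"
    using cl by blast
  show "X \<otimes>\<^bsub>varikon_group\<^esub> Y \<in> carrier varikon_group"
    unfolding u v varikon_group_mult by (rule in_carrier)
  fix Z assume "Z \<in> carrier varikon_group"
  then obtain w where w: "Z = same_effect `` {w}"
    using cl by blast
  show "X \<otimes>\<^bsub>varikon_group\<^esub> Y \<otimes>\<^bsub>varikon_group\<^esub> Z =
      X \<otimes>\<^bsub>varikon_group\<^esub> (Y \<otimes>\<^bsub>varikon_group\<^esub> Z)"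
    unfolding u v w varikon_group_mult by simp
qed

end

theory Submission
  imports Defs
begin

text \<open>
  Describe a configuration by the position of the empty space together with its contents in
  coordinates relative to the empty space. In these coordinates a move acts on the contents by a
  permutation of the seven nonzero cells that does not depend on the configuration, so a sequence
  is determined by the resulting permutation and by the displacement of the empty space. Each move
  is a product of three transpositions, so the sign of the permutation is the parity of the length
  and the third coordinate of the displacement is redundant. Conversely, one explicit sequence
  realises a transposition with trivial \<open>Right\<close> and \<open>Up\<close> displacement, and its conjugates generate
  \<open>S\<^sub>7\<close>.
\<close>

section \<open>Cells relative to the empty space and the permutations induced by moves\<close>

text \<open>
  The numbers from 1 to 7 stand for the nonzero cells by way of the solved configuration; all other
  numbers stand for the cell of the empty space.
\<close>

definition cell_of :: "nat \<Rightarrow> cell" where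
  "cell_of = (\<lambda>_. 0)(7 := (1, 0, 0), 4 := (0, 1, 0), 6 := (0, 0, 1),
     3 := (1, 1, 0), 2 := (0, 1, 1), 5 := (1, 0, 1), 1 := (1, 1, 1))"

text \<open>Translation by \<open>direction m\<close>, written in the labels of
  \<open>cell_of\<close>. The label of \<open>direction m\<close> itself is fixed, because
  translation would send it to the empty cell.\<close>

fun move_perm :: "move \<Rightarrow> nat \<Rightarrow> nat" where
  "move_perm Right = transpose 3 4 \<circ> transpose 5 6 \<circ> transpose 1 2"
| "move_perm Up = transpose 3 7 \<circ> transpose 2 6 \<circ> transpose 1 5"
| "move_perm Back = transpose 5 7 \<circ> transpose 2 4 \<circ> transpose 1 3"

text \<open>The first move is the outermost factor because each move acts on \<open>content\<close>
  by composition on the right. Concatenation thus becomes composition in the same order.\<close>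

fun word_perm :: "move list \<Rightarrow> nat \<Rightarrow> nat" where
  "word_perm [] = id"
| "word_perm (m # w) = move_perm m \<circ> word_perm w"

primrec displacement :: "move list \<Rightarrow> cell" where
  "displacement [] = 0"
| "displacement (m # w) = direction m + displacement w"

definition content :: "config \<Rightarrow> nat \<Rightarrow> nat option" where
  "content c k = c (empty_cell c + cell_of k)"

lemma cell_add_self [simp]: "x + x = (0 :: cell)" "x + (x + y) = (y :: cell)"
  by (cases x; cases y; auto simp: zero_prod_def)+

lemma surj_cell_of: "surj cell_of"
proof (rule surjI)
  fix x :: cell
  \<comment> \<open>\<open>solved\<close> itself supplies a right inverse of \<open>cell_of\<close>;
    0 serves as a label of the empty cell.\<close>
  show "cell_of (case solved x of None \<Rightarrow> 0 | Some k \<Rightarrow> k) = x"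
    by (cases x rule: prod_cases3; rename_tac a b c; case_tac a; case_tac b; case_tac c)
      (simp_all add: solved_def cell_of_def zero_prod_def)
qed

lemma nat_cases_le_7:
  obtains "k = 0" | "k = 1" | "k = 2" | "k = 3" | "k = 4" | "k = 5" | "k = 6" | "k = 7" | "k > (7::nat)"
  by linarith

lemma cell_of_move_perm:
  "cell_of (move_perm m k) =
    (if cell_of k \<in> {0, direction m} then cell_of k else cell_of k + direction m)"
  by (rule nat_cases_le_7[of k]; cases m)
    (simp_all add: cell_of_def transpose_def zero_prod_def)

lemma move_perm_involutive [simp]: "move_perm m (move_perm m k) = k"
  by (rule nat_cases_le_7[of k]; cases m) (simp_all add: transpose_def)

lemma move_perm_permutes: "move_perm m permutes {1..7}"
  by (cases m) (auto intro!: permutes_compose permutes_swap_id)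

lemma word_perm_permutes: "word_perm w permutes {1..7}"
  by (induction w)
    (simp_all only: word_perm.simps permutes_id permutes_compose move_perm_permutes)

lemma word_perm_append: "word_perm (u @ v) = word_perm u \<circ> word_perm v"
  by (induction u) (simp_all add: comp_assoc)

section \<open>Parity of permutations and of displacements\<close>

lemma evenperm_move_perm: "\<not> evenperm (move_perm m)"
  by (cases m) (simp_all add: evenperm_comp permutation_compose permutation_swap_id evenperm_swap)

lemma evenperm_word_perm: "evenperm (word_perm w) \<longleftrightarrow> even (length w)"
proof (induction w)
  case (Cons m w)
  have "permutation (move_perm m)" "permutation (word_perm w)"
    using move_perm_permutes word_perm_permutes permutation_permutes by blast+
  from evenperm_comp[OF this] Cons show ?case
    by (simp only: word_perm.simps evenperm_move_perm length_Cons even_Suc simp_thms)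
qed (simp add: evenperm_id)

lemma displacement_eq:
  "displacement w =
    (of_nat (count_list w Right), of_nat (count_list w Up), of_nat (count_list w Back))"
proof (induction w)
  case (Cons m w)
  then show ?case by (cases m) (simp_all del: add_bit_eq_xor)
qed (simp add: zero_prod_def)

lemma length_eq_count_moves:
  "length w = count_list w Right + count_list w Up + count_list w Back"
proof (induction w)
  case (Cons m w)
  then show ?case by (cases m) simp_all
qed simp

lemma of_nat_bit_eq_iff: "of_nat m = (of_nat n :: bit) \<longleftrightarrow> even m = even n"
proof -
  have "of_nat n = (of_bool (odd n) :: bit)" for n
    by (induction n) simp_all
  then show ?thesis by simp
qed

section \<open>The action of moves in relative coordinates\<close>

lemma empty_cell_apply_move:
  assumes "c \<in> configurations"
  shows "empty_cell (apply_move m c) = empty_cell c + direction m"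
proof -
  have "apply_move m c (empty_cell c + direction m) = None"
    using empty_cell_eq[OF assms, of "empty_cell c"] by (simp add: apply_move_def)
  then show ?thesis
    using empty_cell_eq[OF apply_move_configuration[OF assms]] by metis
qed

text \<open>Put d = \<open>direction m\<close>. The moved piece trades cells with the empty space
  and, since d + d = 0, again lies at d relative to it. All other pieces stay put while the origin
  shifts by d.\<close>

lemma content_apply_move:
  assumes "c \<in> configurations"
  shows "content (apply_move m c) = content c \<circ> move_perm m"
proof
  fix k
  let ?e = "empty_cell c" and ?d = "direction m"
  have "transpose ?e (?e + ?d) (?e + ?d + x) =
      ?e + (if x \<in> {0, ?d} then x else x + ?d)" for x
    by (auto simp: transpose_def add_ac)
      (metis add.commute add.left_commute cell_add_self)+
  then show "content (apply_move m c) k = (content c \<circ> move_perm m) k"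
    unfolding content_def empty_cell_apply_move[OF assms]
    by (simp add: apply_move_def cell_of_move_perm)
qed

lemma empty_cell_run:
  "c \<in> configurations \<Longrightarrow> empty_cell (run w c) = empty_cell c + displacement w"
  by (induction w arbitrary: c)
    (simp_all add: run_def apply_move_configuration empty_cell_apply_move add_ac)

lemma content_run:
  "c \<in> configurations \<Longrightarrow> content (run w c) = content c \<circ> word_perm w"
  by (induction w arbitrary: c)
    (simp_all add: run_def apply_move_configuration content_apply_move comp_assoc)

lemma config_eqI:
  assumes "empty_cell c = empty_cell c'" "content c = content c'"
  shows "c = c'"
proof
  fix p
  obtain k where "cell_of k = empty_cell c + p"
    using surj_cell_of by (metis surjD)
  then have "c p = content c k" "c' p = content c' k"
    using assms(1) by (simp_all add: content_def)
  with assms(2) show "c p = c' p" by simp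
qed

lemma content_solved: "k \<in> {1..7} \<Longrightarrow> content solved k = Some k"
proof -
  have "empty_cell solved = 0"
    using empty_cell_eq[OF solved_configuration, of 0] by (simp add: solved_def zero_prod_def)
  then show "k \<in> {1..7} \<Longrightarrow> content solved k = Some k"
    by (cases rule: nat_cases_le_7[of k])
      (simp_all add: content_def cell_of_def solved_def)
qed

section \<open>Invariants deciding when two sequences agree\<close>

lemma same_effect_iff_displacement:
  "(u, v) \<in> same_effect \<longleftrightarrow> word_perm u = word_perm v \<and> displacement u = displacement v"
proof
  assume "(u, v) \<in> same_effect"
  moreover have "solved \<in> reachable"
    by (metis (mono_tags) mem_Collect_eq reachable_def run_Nil)
  ultimately have eq: "run u solved = run v solved"
    by (auto simp: same_effect_def)
  then have disp: "displacement u = displacement v"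
    using empty_cell_run[OF solved_configuration] by (metis add_left_cancel)
  \<comment> \<open>\<open>solved\<close> carries each label at its own relative cell, so its image
    under a sequence displays the permutation on 1..7. All other numbers are fixed by both
    permutations.\<close>
  have "word_perm u k = word_perm v k" for k
  proof (cases "k \<in> {1..7}")
    case True
    then have "word_perm w k \<in> {1..7}" for w
      using permutes_in_image[OF word_perm_permutes] by blast
    then have "content (run w solved) k = Some (word_perm w k)" for w
      by (simp add: content_run solved_configuration content_solved)
    with eq show ?thesis by (metis option.inject)
  next
    case False
    then show ?thesis
      using permutes_not_in[OF word_perm_permutes] by metis
  qed
  with disp show "word_perm u = word_perm v \<and> displacement u = displacement v" by blast
next
  assume "word_perm u = word_perm v \<and> displacement u = displacement v"
  then show "(u, v) \<in> same_effect"
    using reachable_subset_configurations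
    by (auto simp: same_effect_def empty_cell_run content_run intro!: config_eqI)
qed

text \<open>The residues are integers rather than bits so that they lie in the carrier of
  \<open>integer_mod_group 2\<close>.\<close>

definition invariant :: "move list \<Rightarrow> (nat \<Rightarrow> nat) \<times> int \<times> int" where
  "invariant w =
     (word_perm w, int (count_list w Right) mod 2, int (count_list w Up) mod 2)"

lemma same_effect_iff_invariant: "(u, v) \<in> same_effect \<longleftrightarrow> invariant u = invariant v"
proof -
  have mod: "int m mod 2 = int n mod 2 \<longleftrightarrow> even m = even n" for m n
    by presburger
  \<comment> \<open>The sign yields the parity of the length, which recovers the parity of the
    \<open>Back\<close> count that \<open>invariant\<close> omits.\<close>
  have "even (length u) = even (length v)" if "word_perm u = word_perm v"
    using that by (metis evenperm_word_perm)
  then show ?thesis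
    unfolding same_effect_iff_displacement invariant_def displacement_eq prod.inject
      of_nat_bit_eq_iff mod
    by (auto simp: length_eq_count_moves)
qed

section \<open>Generating all permutations with even \<open>Right\<close> and \<open>Up\<close>
  counts\<close>

lemma exists_word_transpose:
  assumes "a \<in> {1..7}" "b \<in> {1..7}"
  shows "\<exists>w. word_perm w = transpose a b \<and>
    even (count_list w Right) \<and> even (count_list w Up)" (is "?T a b")
proof -
  have T14: "?T 1 4"
  proof (intro exI conjI)
    \<comment> \<open>An explicit witness, checked label by label. It has four \<open>Right\<close>,
      four \<open>Up\<close> and five \<open>Back\<close> moves; a transposition is odd, so the
      length must be odd.\<close>
    let ?w = "[Right, Back, Up, Back, Up, Right, Back, Right, Back, Up, Right, Back, Up]"
    show "word_perm ?w = transpose 1 4"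
    proof
      fix k
      show "word_perm ?w k = transpose 1 4 k"
        by (rule nat_cases_le_7[of k]) (simp_all add: transpose_def)
    qed
  qed simp_all
  \<comment> \<open>\<open>move_perm m\<close> is an involution, so surrounding a word by
    \<open>m\<close> conjugates its permutation; the two added moves preserve both parities.\<close>
  have conj: "?T (move_perm m a) (move_perm m b)" if "?T a b" for m a b
  proof -
    from that obtain w where w: "word_perm w = transpose a b"
      "even (count_list w Right)" "even (count_list w Up)" by blast
    have "move_perm m \<circ> transpose a b \<circ> move_perm m =
        transpose (move_perm m a) (move_perm m b)"
      by (auto simp: fun_eq_iff transpose_def)
    with w show ?thesis
      by (intro exI[of _ "m # w @ [m]"]) (auto simp: word_perm_append comp_assoc)
  qed
  have sym: "?T b a" if "?T a b" for a b
    using that by (simp add: transpose_commute)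
  have trans: "?T a c" if ab: "?T a b" and bc: "?T b c" for a b c
  proof (cases "a = b \<or> b = c \<or> a = c")
    case True
    then consider "a = b" | "b = c" | "a = c" by blast
    then show ?thesis
    proof cases
      case 3
      show ?thesis unfolding 3 by (intro exI[of _ "[]"]) simp
    qed (use ab bc in simp_all)
  next
    case False
    from ab obtain u where u: "word_perm u = transpose a b"
      "even (count_list u Right)" "even (count_list u Up)" by blast
    from bc obtain v where v: "word_perm v = transpose b c"
      "even (count_list v Right)" "even (count_list v Up)" by blast
    \<comment> \<open>Conjugating (b c) by (a b) gives (a c). With a and b distinct this fails when
      c is one of them, hence the separate treatment of coincidences.\<close>
    have "transpose a b \<circ> (transpose b c \<circ> transpose a b) = transpose a c"
      using False by (auto simp: fun_eq_iff transpose_def)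
    with u v show ?thesis
      by (intro exI[of _ "u @ v @ u"]) (simp add: word_perm_append)
  qed
  \<comment> \<open>Together with \<open>T14\<close>, the conjugates found here form the path
    1-4-5-7-6-3-2 through all labels; \<open>trans\<close> along it links 1 to each of them.\<close>
  have T23: "?T 2 3" using conj[OF T14, of Right] by (simp add: transpose_def)
  have T54: "?T 5 4" using conj[OF T14, of Up] by (simp add: transpose_def)
  have T63: "?T 6 3" using conj[OF T54, of Right] by (simp add: transpose_def)
  have T67: "?T 6 7" using conj[OF T23, of Up] by (simp add: transpose_def)
  have T57: "?T 5 7" using conj[OF T67, of Right] by (simp add: transpose_def)
  have T15: "?T 1 5" using trans[OF T14 sym[OF T54]] .
  have T17: "?T 1 7" using trans[OF T15 T57] .
  have T16: "?T 1 6" using trans[OF T17 sym[OF T67]] .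
  have T13: "?T 1 3" using trans[OF T16 T63] .
  have T12: "?T 1 2" using trans[OF T13 sym[OF T23]] .
  have T11: "?T 1 1" by (intro exI[of _ "[]"]) simp
  have T1: "?T 1 k" if "k \<in> {1..7}" for k
  proof -
    from that have "k = 1 \<or> k = 2 \<or> k = 3 \<or> k = 4 \<or> k = 5 \<or> k = 6 \<or> k = 7"
      by auto
    then show ?thesis
      using T11 T12 T13 T14 T15 T16 T17 by (elim disjE) (simp_all only:)
  qed
  show ?thesis
    by (rule trans[OF sym[OF T1[OF assms(1)]] T1[OF assms(2)]])
qed

lemma exists_word_perm:
  assumes "p permutes {1..7}"
  shows "\<exists>w. word_perm w = p \<and> even (count_list w Right) \<and> even (count_list w Up)"
  using assms finite_atLeastAtMost
proof (induction rule: permutes_induct)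
  case id
  show ?case by (intro exI[of _ "[]"]) simp
next
  case (swap a b p)
  obtain u where "word_perm u = transpose a b"
    "even (count_list u Right)" "even (count_list u Up)"
    using exists_word_transpose[OF swap(1,2)] by blast
  moreover obtain v where "word_perm v = p"
    "even (count_list v Right)" "even (count_list v Up)"
    using swap by blast
  ultimately show ?case
    by (intro exI[of _ "u @ v"]) (simp add: word_perm_append)
qed

section \<open>The image of the invariant and the isomorphism\<close>

lemma range_invariant: "range invariant = {p. p permutes {1..7}} \<times> {0..<2} \<times> {0..<2}"
proof (intro equalityI subsetI)
  fix z assume "z \<in> {p. p permutes {1..7::nat}} \<times> {0..<2::int} \<times> {0..<2::int}"
  then obtain p x y where z: "z = (p, x, y)" and p: "p permutes {1..7}"
    and x: "x \<in> {0..<2}" and y: "y \<in> {0..<2}" by blast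
  \<comment> \<open>First \<open>s\<close> realises the prescribed residues; then \<open>w\<close>
    corrects the permutation without changing them.\<close>
  define s where "s = replicate (nat x) Right @ replicate (nat y) Up"
  have "inv' (word_perm s) \<circ> p permutes {1..7}"
    using p by (intro permutes_compose permutes_inv word_perm_permutes)
  then obtain w where w: "word_perm w = inv' (word_perm s) \<circ> p"
    "even (count_list w Right)" "even (count_list w Up)"
    using exists_word_perm by blast
  have "word_perm (s @ w) = p"
    unfolding word_perm_append w(1) comp_assoc[symmetric] permutes_inv_o(1)[OF word_perm_permutes]
    by simp
  moreover have "count_list (replicate n m) m' = (if m = m' then n else 0)" for n and m m' :: move
    by (induction n) auto
  then have "count_list s Right = nat x" "count_list s Up = nat y"
    by (simp_all add: s_def)
  moreover have "(x + int n) mod 2 = x" "(y + int n) mod 2 = y" if "even n" for n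
    using that x y by (simp; presburger)+
  ultimately have "invariant (s @ w) = z"
    using w(2,3) x y by (simp add: invariant_def z)
  then show "z \<in> range invariant" by blast
qed (auto simp: invariant_def word_perm_permutes simp del: One_nat_def)

theorem theorem4p4:
  shows "varikon_group \<cong> sym_group 7 \<times>\<times> (integer_mod_group 2 \<times>\<times> integer_mod_group 2)"
proof (rule is_isoI)
  let ?H = "sym_group 7 \<times>\<times> (integer_mod_group 2 \<times>\<times> integer_mod_group 2)"
  \<comment> \<open>\<open>invariant\<close> is constant on each class, so its image there is a
    singleton and \<open>the_elem\<close> returns the common value.\<close>
  define f where "f X = the_elem (invariant ` X)" for X
  have f: "f (same_effect `` {w}) = invariant w" for w
  proof -
    have "invariant ` (same_effect `` {w}) = {invariant w}"
      by (auto simp: same_effect_iff_invariant)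
    then show ?thesis by (simp add: f_def)
  qed
  have carrier: "carrier varikon_group = range (\<lambda>w. same_effect `` {w})"
    by (auto simp: varikon_group_def quotient_def)
  have carrier_H: "carrier ?H = range invariant"
    by (simp add: range_invariant DirProd_def sym_group_def carrier_integer_mod_group)
  have mult: "invariant (u @ v) = monoid.mult ?H (invariant u) (invariant v)" for u v
    by (simp add: invariant_def word_perm_append DirProd_def sym_group_mult mod_add_eq)
  have "f \<in> hom varikon_group ?H"
    unfolding hom_def carrier carrier_H by (auto simp: f varikon_group_mult mult)
  moreover have "f ` carrier varikon_group = carrier ?H"
    unfolding carrier carrier_H by (simp add: image_image f)
  moreover have "inj_on f (carrier varikon_group)"
    unfolding carrier
    by (auto simp: inj_on_def f same_effect_iff_invariant)
  ultimately show "f \<in> iso varikon_group ?H"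
    by (simp add: iso_iff)
qed

end
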